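(* A tree $T$ satisfies $sd_{\gamma_{sp}}(T)=1$ (i.e., is in Class 1) if and only if $T\in\mathscr{P}$, where $\mathscr{P}$ is the set of all nontrivial trees that do not belong to $\mathscr{U}$.
   Context: For $S\subseteq V(G)$, $\overline{S}=V(G)\setminus S$. A set $S$ is a super dominating set of $G$ if for every $u\in\overline{S}$ there exists $v\in S$ with $N(v)\cap\overline{S}=\{u\}$ ($N(v)$ the open neighborhood); in that case $v$ is called an external private neighbor of $u$ with respect to $\overline{S}$. $\gamma_{sp}(G)$ is the minimum cardinality of a super dominating set, and a $\gamma_{sp}(G)$-set is a super dominating set of that cardinality. For a super dominating set $S$, let $Q_S(G)$ be the set of vertices $u\in\overline{S}$ that have exactly one external private neighbor with respect to $\overline{S}$, and $U_S(G)$ the set of vertices $v$ that are the unique external private neighbor of some $u\in Q_S(G)$. The super domination subdivision number $sd_{\gamma_{sp}}(G)$ is the minimum number of edges that must be subdivided (each edge at most once; subdividing $uv$ replaces it by a path $uxv$ with a new vertex $x$) in order to increase $\gamma_{sp}(G)$. A tree is in Class 1 or Class 2 according as $sd_{\gamma_{sp}}(T)$ equals $1$ or $2$. Operation $\mathscr{U}_1$: given a tree $T'$ and a vertex $v$ of $T'$ for which there exists a $\gamma_{sp}(T')$-set $S$ with either $N_{T'}[v]\cap\overline{S}=\emptyset$, or $v\notin\overline{S}$ and $N_{T'}[v]\cap U_S(T')=\emptyset$, add a new star of order at least two and join its center vertex to $v$. The family $\mathscr{U}$ consists of all trees obtained from a star of order at least three by a finite (possibly empty) sequence of operations $\mathscr{U}_1$.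 A nontrivial tree is a tree with at least two vertices. *)

theory Defs
  imports "HOL-Library.Extended_Nat"
begin

section \<open>Finite simple graphs and trees\<close>

text \<open>
  Edges are two-element vertex sets. (The \<open>tree\<close> predicate of the AFP entry Graph\_Theory is not
  usable here: on a symmetric digraph, every edge together with its reverse is a cycle.)
\<close>

record 'a ugraph =
  verts :: "'a set"
  edges :: "'a set set"

definition simple_graph :: "'a ugraph \<Rightarrow> bool" where
  "simple_graph G \<longleftrightarrow> finite (verts G) \<and>
     (\<forall>e\<in>edges G. \<exists>u\<in>verts G. \<exists>v\<in>verts G. u \<noteq> v \<and> e = {u, v})"

definition neighborhood :: "'a ugraph \<Rightarrow> 'a \<Rightarrow> 'a set" where
  "neighborhood G v = {u. {v, u} \<in> edges G}"

definition closed_neighborhood :: "'a ugraph \<Rightarrow> 'a \<Rightarrow> 'a set" where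
  "closed_neighborhood G v = insert v (neighborhood G v)"

definition connected_graph :: "'a ugraph \<Rightarrow> bool" where
  "connected_graph G \<longleftrightarrow> verts G \<noteq> {} \<and>
     (\<forall>u\<in>verts G. \<forall>v\<in>verts G. (u, v) \<in> {(x, y). {x, y} \<in> edges G}\<^sup>*)"

definition graph_cycle :: "'a ugraph \<Rightarrow> 'a list \<Rightarrow> bool" where
  "graph_cycle G p \<longleftrightarrow> length p \<ge> 3 \<and> distinct p \<and>
     successively (\<lambda>x y. {x, y} \<in> edges G) p \<and> {last p, hd p} \<in> edges G"

definition is_tree :: "'a ugraph \<Rightarrow> bool" where
  "is_tree G \<longleftrightarrow> simple_graph G \<and> connected_graph G \<and> \<not> (\<exists>p. graph_cycle G p)"


section \<open>Super domination\<close>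

definition super_dominating :: "'a ugraph \<Rightarrow> 'a set \<Rightarrow> bool" where
  "super_dominating G S \<longleftrightarrow> S \<subseteq> verts G \<and>
     (\<forall>u \<in> verts G - S. \<exists>v\<in>S. neighborhood G v \<inter> (verts G - S) = {u})"

definition gamma_sp :: "'a ugraph \<Rightarrow> nat" where
  "gamma_sp G = (LEAST k. \<exists>S. super_dominating G S \<and> card S = k)"

definition gamma_sp_set :: "'a ugraph \<Rightarrow> 'a set \<Rightarrow> bool" where
  "gamma_sp_set G S \<longleftrightarrow> super_dominating G S \<and> card S = gamma_sp G"

definition ext_private_nbrs :: "'a ugraph \<Rightarrow> 'a set \<Rightarrow> 'a \<Rightarrow> 'a set" where
  "ext_private_nbrs G S u = {v\<in>S. neighborhood G v \<inter> (verts G - S) = {u}}"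

definition Q_set :: "'a ugraph \<Rightarrow> 'a set \<Rightarrow> 'a set" where
  "Q_set G S = {u \<in> verts G - S. \<exists>!v. v \<in> ext_private_nbrs G S u}"

definition U_set :: "'a ugraph \<Rightarrow> 'a set \<Rightarrow> 'a set" where
  "U_set G S = {v. \<exists>u \<in> Q_set G S. v \<in> ext_private_nbrs G S u}"


section \<open>Subdivision\<close>

text \<open>
  The old vertices are the \<open>Inl v\<close>; the new vertex placed on a subdivided edge \<open>e\<close> is \<open>Inr e\<close>.
\<close>

definition subdivide_edges :: "'a ugraph \<Rightarrow> 'a set set \<Rightarrow> ('a + 'a set) ugraph" where
  "subdivide_edges G F =
     \<lparr>verts = Inl ` verts G \<union> Inr ` F,
      edges = {Inl ` e |e. e \<in> edges G - F} \<union> {{Inl u, Inr e} |u e. e \<in> F \<and> u \<in> e}\<rparr>"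

text \<open>
  The value is \<open>\<infinity>\<close> if no set of subdivisions increases the super domination number, for instance
  if the graph has no edges.
\<close>

definition sd_gamma_sp :: "'a ugraph \<Rightarrow> enat" where
  "sd_gamma_sp G =
     Inf {enat (card F) |F. F \<subseteq> edges G \<and> gamma_sp (subdivide_edges G F) > gamma_sp G}"


section \<open>The families U and P\<close>

text \<open>The star with center \<open>c\<close> and set of leaves \<open>L\<close>; its order is \<open>card L + 1\<close>.\<close>

definition star :: "'a \<Rightarrow> 'a set \<Rightarrow> 'a ugraph" where
  "star c L = \<lparr>verts = insert c L, edges = {{c, x} |x. x \<in> L}\<rparr>"

definition join_star :: "'a ugraph \<Rightarrow> 'a \<Rightarrow> 'a \<Rightarrow> 'a set \<Rightarrow> 'a ugraph" where
  "join_star G v c L =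
     \<lparr>verts = verts G \<union> verts (star c L),
      edges = edges G \<union> edges (star c L) \<union> {{v, c}}\<rparr>"

definition U1_vertex :: "'a ugraph \<Rightarrow> 'a \<Rightarrow> bool" where
  "U1_vertex G v \<longleftrightarrow> v \<in> verts G \<and>
     (\<exists>S. gamma_sp_set G S \<and>
        (closed_neighborhood G v \<inter> (verts G - S) = {} \<or>
         v \<notin> verts G - S \<and> closed_neighborhood G v \<inter> U_set G S = {}))"

text \<open>
  Centers and leaves are arbitrary (fresh) elements of the vertex type, so the family is closed
  under isomorphism: every intermediate tree in a construction of \<open>T\<close> is a subtree of \<open>T\<close>.
\<close>

inductive_set family_U :: "'a ugraph set" where
  base: "\<lbrakk>finite L; c \<notin> L; card L + 1 \<ge> 3\<rbrakk> \<Longrightarrow> star c L \<in> family_U"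
| op_U1: "\<lbrakk>T' \<in> family_U; U1_vertex T' v;
           finite L; c \<notin> L; card L + 1 \<ge> 2;
           verts (star c L) \<inter> verts T' = {}\<rbrakk>
          \<Longrightarrow> join_star T' v c L \<in> family_U"

definition family_P :: "'a ugraph set" where
  "family_P = {T. is_tree T \<and> card (verts T) \<ge> 2 \<and> T \<notin> family_U}"

end

theory Submission
  imports Defs
begin

text \<open>
  On a forest every set of edges \<open>M\<close> is a cut: the vertices can be 2-coloured so that exactly the
  edges in \<open>M\<close> are bichromatic. If \<open>M\<close> is a matching, the complement of one colour class of the
  matched vertices is super dominating, whence \<open>\<gamma>\<^sub>s\<^sub>p = n - \<nu>\<close> with \<open>\<nu>\<close> the matching number.
  Subdividing an edge therefore increases \<open>\<gamma>\<^sub>s\<^sub>p\<close> iff it leaves \<open>\<nu>\<close> unchanged, which happens iff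
  no endpoint of the edge is missed by a maximum matching. Likewise operation \<open>\<U>\<^sub>1\<close> applies at
  a vertex iff some maximum matching misses it. That every edge has an endpoint missed
  by some maximum matching is then seen to characterise \<open>\<U>\<close> by removing a pendant
  star at the end of a longest path.
\<close>

section \<open>Graphs and matchings\<close>

lemma simple_graph_edgeE:
  assumes "simple_graph G" "e \<in> edges G"
  obtains u v where "u \<in> verts G" "v \<in> verts G" "u \<noteq> v" "e = {u, v}"
  using assms unfolding simple_graph_def by blast

lemma simple_graph_edgeD:
  assumes "simple_graph G" "{u, v} \<in> edges G"
  shows "u \<in> verts G" "v \<in> verts G" "u \<noteq> v"
  using simple_graph_edgeE[OF assms] by (metis doubleton_eq_iff)+

lemma simple_graph_edge_atE:
  assumes "simple_graph G" "e \<in> edges G" "u \<in> e"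
  obtains w where "w \<in> verts G" "u \<noteq> w" "e = {u, w}"
proof -
  obtain a b where "a \<in> verts G" "b \<in> verts G" "a \<noteq> b" "e = {a, b}"
    using simple_graph_edgeE[OF assms(1,2)] .
  then show thesis
    using assms(3) that[of a] that[of b] by (auto simp: insert_commute)
qed

lemma simple_graph_finite_edges:
  assumes "simple_graph G"
  shows "finite (edges G)"
proof (rule finite_subset)
  show "edges G \<subseteq> Pow (verts G)"
    using simple_graph_edgeE[OF assms] by blast
  show "finite (Pow (verts G))"
    using assms unfolding simple_graph_def by blast
qed

definition matching :: "'a ugraph \<Rightarrow> 'a set set \<Rightarrow> bool" where
  "matching G M \<longleftrightarrow> M \<subseteq> edges G \<and> pairwise disjnt M"

definition matching_number :: "'a ugraph \<Rightarrow> nat" where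
  "matching_number G = Max (card ` {M. matching G M})"

definition maximum_matching :: "'a ugraph \<Rightarrow> 'a set set \<Rightarrow> bool" where
  "maximum_matching G M \<longleftrightarrow> matching G M \<and> card M = matching_number G"

text \<open>For vertices of the graph, this is membership in the set usually called D in the
  Gallai-Edmonds decomposition.\<close>

definition inessential :: "'a ugraph \<Rightarrow> 'a \<Rightarrow> bool" where
  "inessential G v \<longleftrightarrow> (\<exists>M. maximum_matching G M \<and> v \<notin> \<Union>M)"

lemma matching_eqI:
  assumes "matching G M" "d \<in> M" "e \<in> M" "x \<in> d" "x \<in> e"
  shows "d = e"
  using assms unfolding matching_def pairwise_def disjnt_def by blast

lemma matching_finite:
  assumes "simple_graph G" "matching G M"
  shows "finite M"
  using assms simple_graph_finite_edges finite_subset unfolding matching_def by blast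

lemma finite_matchings:
  assumes "simple_graph G"
  shows "finite {M. matching G M}"
proof (rule finite_subset)
  show "{M. matching G M} \<subseteq> Pow (edges G)"
    unfolding matching_def by blast
  show "finite (Pow (edges G))"
    using simple_graph_finite_edges[OF assms] by blast
qed

lemma matching_card_le:
  assumes "simple_graph G" "matching G M"
  shows "card M \<le> matching_number G"
  unfolding matching_number_def using assms finite_matchings by (intro Max_ge) auto

lemma maximum_matching_exists:
  assumes "simple_graph G"
  obtains M where "maximum_matching G M"
proof -
  have "matching G {}"
    unfolding matching_def by simp
  then have "Max (card ` {M. matching G M}) \<in> card ` {M. matching G M}"
    using finite_matchings[OF assms] by (intro Max_in) auto
  then show thesis
    using that unfolding maximum_matching_def matching_number_def by auto
qed

lemma maximum_matchingI:
  assumes "simple_graph G" "matching G M" "matching_number G \<le> card M"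
  shows "maximum_matching G M"
  using assms matching_card_le unfolding maximum_matching_def by fastforce

section \<open>Super dominating sets and matchings\<close>

text \<open>For simple graphs this is acyclicity in disguise: a single edge of a cycle is never a
  cut. The cut form supplies the needed colourings at once and passes to subdivisions and star joins
  without any argument about cycles.\<close>

definition balanced :: "'a ugraph \<Rightarrow> bool" where
  "balanced G \<longleftrightarrow> (\<forall>M. \<exists>f :: 'a \<Rightarrow> bool. \<forall>x y. {x, y} \<in> edges G \<longrightarrow> (f x \<noteq> f y \<longleftrightarrow> {x, y} \<in> M))"

lemma balancedD:
  assumes "balanced (G :: 'a ugraph)"
  shows "\<exists>f :: 'a \<Rightarrow> bool. \<forall>x y. {x, y} \<in> edges G \<longrightarrow> (f x \<noteq> f y \<longleftrightarrow> {x, y} \<in> M)"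
  using assms unfolding balanced_def by blast

lemma balancedE:
  assumes "balanced G"
  obtains f :: "'a \<Rightarrow> bool"
  where "f v" "\<And>x y. {x, y} \<in> edges (G :: 'a ugraph) \<Longrightarrow> f x \<noteq> f y \<longleftrightarrow> {x, y} \<in> M"
proof -
  obtain f :: "'a \<Rightarrow> bool" where f: "\<And>x y. {x, y} \<in> edges G \<Longrightarrow> f x \<noteq> f y \<longleftrightarrow> {x, y} \<in> M"
    using balancedD[OF assms, of M] by blast
  show thesis
    \<comment> \<open>Swapping the two colours preserves the bichromatic edges, so \<open>v\<close>
      may be given the colour \<open>True\<close>.\<close>
    by (rule that[of "\<lambda>x. f x = f v"]) (use f in blast)+
qed

text \<open>A private neighbor sees only one vertex of the complement, so different vertices have
  different private neighbors. These lie in \<open>S\<close>, their partners outside it, so the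
  chosen edges cannot meet.\<close>

lemma matching_of_private_nbrs:
  assumes "\<And>u. u \<in> verts G - S \<Longrightarrow> g u \<in> ext_private_nbrs G S u"
  defines "M \<equiv> (\<lambda>u. {u, g u}) ` (verts G - S)"
  shows "matching G M" "card M = card (verts G - S)"
proof -
  have g: "g u \<in> S" "neighborhood G (g u) \<inter> (verts G - S) = {u}" if "u \<in> verts G - S" for u
    using assms(1)[OF that] unfolding ext_private_nbrs_def by auto
  have disj: "{u, g u} \<inter> {w, g w} = {}" if "u \<in> verts G - S" "w \<in> verts G - S" "u \<noteq> w" for u w
  proof -
    have "g u \<noteq> g w"
      using g(2)[OF that(1)] g(2)[OF that(2)] that(3) by (metis singleton_inject)
    then show ?thesis
      using g(1)[OF that(1)] g(1)[OF that(2)] that by blast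
  qed
  have "{u, g u} \<in> edges G" if "u \<in> verts G - S" for u
    using g(2)[OF that] unfolding neighborhood_def by (auto simp: insert_commute)
  then have "M \<subseteq> edges G"
    unfolding M_def by blast
  moreover have "pairwise disjnt M"
    unfolding M_def using disj by (intro pairwise_imageI) (simp add: disjnt_def)
  ultimately show "matching G M"
    unfolding matching_def ..
  have "inj_on (\<lambda>u. {u, g u}) (verts G - S)"
    using disj by (intro inj_onI) blast
  then show "card M = card (verts G - S)"
    unfolding M_def by (rule card_image)
qed

section \<open>Super domination number and matching number\<close>

lemma super_dominating_iff:
  "super_dominating G S \<longleftrightarrow>
     S \<subseteq> verts G \<and> (\<forall>u \<in> verts G - S. ext_private_nbrs G S u \<noteq> {})"
  unfolding super_dominating_def ext_private_nbrs_def by blast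

lemma super_dominating_card_ge:
  assumes "simple_graph G" "super_dominating G S"
  shows "card (verts G - S) \<le> matching_number G"
proof -
  have "\<forall>u \<in> verts G - S. \<exists>w. w \<in> ext_private_nbrs G S u"
    using assms(2) unfolding super_dominating_iff by blast
  then obtain g where "\<And>u. u \<in> verts G - S \<Longrightarrow> g u \<in> ext_private_nbrs G S u"
    by metis
  from matching_of_private_nbrs[OF this] show ?thesis
    using matching_card_le[OF assms(1)] by metis
qed

text \<open>Colour the vertices so that exactly the matching edges are bichromatic, and remove the
  matched vertices of one colour. The matching partner of a removed vertex is then its private
  neighbor. The clause on \<open>v\<close> is what operation \<open>U1\<close> needs.\<close>

lemma super_dominating_of_matching:
  assumes G: "simple_graph G" "balanced G" and M: "matching G M"
  obtains S where "super_dominating G S" "card M \<le> card (verts G - S)"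
    "v \<notin> \<Union>M \<Longrightarrow> closed_neighborhood G v \<inter> (verts G - S) = {}"
proof -
  obtain f where fv: "f v"
    and f: "\<And>x y. {x, y} \<in> edges G \<Longrightarrow> f x \<noteq> f y \<longleftrightarrow> {x, y} \<in> M"
    using balancedE[OF G(2)] by blast
  \<comment> \<open>\<open>X\<close> is the complement of the super dominating set to be built;
    \<open>v\<close>, coloured \<open>True\<close>, stays outside it.\<close>
  define X where "X = {x \<in> \<Union>M. \<not> f x}"
  have X_verts: "X \<subseteq> verts G"
    using M simple_graph_edgeE[OF G(1)] unfolding X_def matching_def by blast
  then have X: "verts G - (verts G - X) = X"
    by blast
  have "ext_private_nbrs G (verts G - X) u \<noteq> {}" if u: "u \<in> X" for u
  proof -
    obtain e where e: "e \<in> M" "u \<in> e" "\<not> f u"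
      using u unfolding X_def by blast
    then have "e \<in> edges G"
      using M unfolding matching_def by blast
    then obtain w where w: "e = {u, w}" "w \<in> verts G"
      using simple_graph_edge_atE[OF G(1) _ e(2)] by metis
    have "f w"
      using f[of u w] e w \<open>e \<in> edges G\<close> by simp
    \<comment> \<open>An edge from \<open>w\<close> into \<open>X\<close> is bichromatic, hence a
      matching edge at \<open>w\<close>, hence the edge \<open>e\<close> itself.\<close>
    have "u' = u" if "{w, u'} \<in> edges G" "u' \<in> X" for u'
    proof -
      have "{w, u'} \<in> M"
        using f[OF that(1)] that(2) \<open>f w\<close> unfolding X_def by simp
      then have "{w, u'} = e"
        using matching_eqI[OF M] e(1) w(1) by (metis insertCI)
      then show ?thesis
        using w(1) \<open>f w\<close> \<open>\<not> f u\<close> by (auto simp: doubleton_eq_iff)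
    qed
    then have "neighborhood G w \<inter> X = {u}"
      using u \<open>e \<in> edges G\<close> w(1) unfolding neighborhood_def by (auto simp: insert_commute)
    moreover have "w \<in> verts G - X"
      using w(2) \<open>f w\<close> unfolding X_def by blast
    ultimately show ?thesis
      unfolding ext_private_nbrs_def X by blast
  qed
  then have S: "super_dominating G (verts G - X)"
    unfolding super_dominating_iff X by blast
  have "\<exists>x\<in>X. x \<in> e" if e: "e \<in> M" for e
  proof -
    have "e \<in> edges G"
      using M e unfolding matching_def by blast
    with simple_graph_edgeE[OF G(1)] obtain x y where xy: "e = {x, y}"
      by metis
    then have "\<not> f x \<or> \<not> f y"
      using f[of x y] e \<open>e \<in> edges G\<close> by simp
    then show ?thesis
      using xy e unfolding X_def by blast
  qed
  then have "\<And>e. \<exists>x. e \<in> M \<longrightarrow> x \<in> X \<and> x \<in> e"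
    by blast
  then obtain h where h: "\<And>e. e \<in> M \<Longrightarrow> h e \<in> X \<and> h e \<in> e"
    by metis
  \<comment> \<open>\<open>h\<close> picks from each matching edge an endpoint in \<open>X\<close>;
    disjointness of the edges makes it injective, so \<open>X\<close> is large enough.\<close>
  have "inj_on h M"
    using h matching_eqI[OF M] by (intro inj_onI) metis
  moreover have "finite X"
    using X_verts G(1) finite_subset unfolding simple_graph_def by blast
  ultimately have "card M \<le> card X"
    using h by (intro card_inj_on_le) auto
  \<comment> \<open>No edge at an unmatched \<open>v\<close> belongs to \<open>M\<close>, so all
    neighbors of \<open>v\<close> share its colour \<open>True\<close>.\<close>
  moreover have "closed_neighborhood G v \<inter> X = {}" if "v \<notin> \<Union>M"
    using that fv f[of v] unfolding closed_neighborhood_def neighborhood_def X_def by blast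
  ultimately show thesis
    using S that[of "verts G - X"] unfolding X by blast
qed

lemma gamma_sp_add_matching_number:
  assumes "simple_graph G" "balanced G"
  shows "gamma_sp G + matching_number G = card (verts G)"
proof -
  have fin: "finite (verts G)"
    using assms(1) unfolding simple_graph_def by blast
  have card_S: "card S + card (verts G - S) = card (verts G)" if "super_dominating G S" for S
    using that fin unfolding super_dominating_def
    by (metis card_Diff_subset card_mono finite_subset le_add_diff_inverse)
  obtain M where M: "maximum_matching G M"
    using maximum_matching_exists[OF assms(1)] .
  then obtain S where S: "super_dominating G S" "matching_number G \<le> card (verts G - S)"
    using super_dominating_of_matching[OF assms] unfolding maximum_matching_def by metis
  have "gamma_sp G = card (verts G) - matching_number G"
    unfolding gamma_sp_def
  proof (rule Least_equality)
    show "\<exists>S. super_dominating G S \<and> card S = card (verts G) - matching_number G"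
      using S card_S[OF S(1)] super_dominating_card_ge[OF assms(1) S(1)]
      by (intro exI[of _ S]) auto
  next
    fix k
    assume "\<exists>S. super_dominating G S \<and> card S = k"
    then show "card (verts G) - matching_number G \<le> k"
      using card_S super_dominating_card_ge[OF assms(1)] by fastforce
  qed
  then show ?thesis
    using S card_S[OF S(1)] by linarith
qed

lemma gamma_sp_set_iff:
  assumes "simple_graph G" "balanced G"
  shows "gamma_sp_set G S \<longleftrightarrow>
    super_dominating G S \<and> matching_number G \<le> card (verts G - S)"
proof -
  have "card S + card (verts G - S) = card (verts G)" if "super_dominating G S"
    using that assms(1) unfolding super_dominating_def simple_graph_def
    by (metis card_Diff_subset card_mono finite_subset le_add_diff_inverse)
  then show ?thesis
    using gamma_sp_add_matching_number[OF assms] super_dominating_card_ge[OF assms(1), of S]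
    unfolding gamma_sp_set_def by auto
qed

text \<open>Either alternative in \<open>U1_vertex\<close> lets every vertex outside
  \<open>S\<close> choose a private neighbor other than \<open>v\<close>, and the resulting maximum
  matching misses \<open>v\<close>. Conversely, a maximum matching missing \<open>v\<close> already
  yields the first alternative.\<close>

lemma U1_vertex_iff_inessential:
  assumes G: "simple_graph G" "balanced G" and v: "v \<in> verts G"
  shows "U1_vertex G v \<longleftrightarrow> inessential G v"
proof
  assume "U1_vertex G v"
  then obtain S where S: "gamma_sp_set G S"
    and alt: "closed_neighborhood G v \<inter> (verts G - S) = {} \<or>
      v \<notin> verts G - S \<and> closed_neighborhood G v \<inter> U_set G S = {}"
    unfolding U1_vertex_def by blast
  have dom: "super_dominating G S" and max: "matching_number G \<le> card (verts G - S)"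
    using S gamma_sp_set_iff[OF G] by auto
  have vS: "v \<notin> verts G - S"
    using alt unfolding closed_neighborhood_def by blast
  have "\<exists>w. w \<in> ext_private_nbrs G S u \<and> w \<noteq> v" if u: "u \<in> verts G - S" for u
  proof (rule ccontr)
    assume only: "\<nexists>w. w \<in> ext_private_nbrs G S u \<and> w \<noteq> v"
    have ne: "ext_private_nbrs G S u \<noteq> {}"
      using dom u unfolding super_dominating_iff by blast
    \<comment> \<open>If \<open>v\<close> were the sole choice for \<open>u\<close>, then
      \<open>u\<close> would refute the first alternative and \<open>v\<close>, lying in
      \<open>U_set G S\<close>, the second.\<close>
    with only have vu: "v \<in> ext_private_nbrs G S u"
      by blast
    then have "u \<in> neighborhood G v \<inter> (verts G - S)"
      unfolding ext_private_nbrs_def by blast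
    moreover have "v \<in> U_set G S"
      using only vu u unfolding U_set_def Q_set_def by blast
    ultimately show False
      using alt unfolding closed_neighborhood_def by blast
  qed
  then obtain g where g: "\<And>u. u \<in> verts G - S \<Longrightarrow> g u \<in> ext_private_nbrs G S u \<and> g u \<noteq> v"
    by metis
  define M where "M = (\<lambda>u. {u, g u}) ` (verts G - S)"
  have "matching G M" "card M = card (verts G - S)"
    unfolding M_def using matching_of_private_nbrs[of G S g] g by auto
  then have "maximum_matching G M"
    using max maximum_matchingI[OF G(1)] by simp
  moreover have "v \<notin> \<Union>M"
    using vS g unfolding M_def by auto
  ultimately show "inessential G v"
    unfolding inessential_def by blast
next
  assume "inessential G v"
  then obtain M where M: "matching G M" "card M = matching_number G" "v \<notin> \<Union>M"
    unfolding inessential_def maximum_matching_def by blast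
  obtain S where "super_dominating G S" "card M \<le> card (verts G - S)"
    "closed_neighborhood G v \<inter> (verts G - S) = {}"
    using super_dominating_of_matching[OF G M(1)] M(3) by metis
  then show "U1_vertex G v"
    using v M(2) gamma_sp_set_iff[OF G] unfolding U1_vertex_def by metis
qed

section \<open>Subdivision\<close>

lemma verts_subdivide_edges [simp]:
  "verts (subdivide_edges G F) = Inl ` verts G \<union> Inr ` F"
  unfolding subdivide_edges_def by simp

lemma edges_subdivide_edges [simp]:
  "edges (subdivide_edges G F) =
     {Inl ` e |e. e \<in> edges G - F} \<union> {{Inl u, Inr e} |u e. e \<in> F \<and> u \<in> e}"
  unfolding subdivide_edges_def by simp

lemma simple_graph_subdivide_edges:
  assumes "simple_graph G" "F \<subseteq> edges G"
  shows "simple_graph (subdivide_edges G F)"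
  unfolding simple_graph_def
proof (intro conjI ballI)
  show "finite (verts (subdivide_edges G F))"
    using assms simple_graph_finite_edges[OF assms(1)] finite_subset
    unfolding simple_graph_def by auto
  fix d
  assume "d \<in> edges (subdivide_edges G F)"
  then consider e where "e \<in> edges G" "d = Inl ` e" | u e where "e \<in> F" "u \<in> e" "d = {Inl u, Inr e}"
    by auto
  then show "\<exists>u\<in>verts (subdivide_edges G F). \<exists>v\<in>verts (subdivide_edges G F). u \<noteq> v \<and> d = {u, v}"
  proof cases
    case 1
    with simple_graph_edgeE[OF assms(1)] obtain u v
      where "u \<in> verts G" "v \<in> verts G" "u \<noteq> v" "e = {u, v}" by metis
    then show ?thesis
      unfolding 1(2) by - (rule bexI[of _ "Inl u"], rule bexI[of _ "Inl v"], auto)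
  next
    case 2
    then have "u \<in> verts G"
      using simple_graph_edgeE[OF assms(1)] assms(2) by blast
    then show ?thesis
      unfolding 2(3) using 2(1) by - (rule bexI[of _ "Inl u"], rule bexI[of _ "Inr e"], auto)
  qed
qed

text \<open>A parity argument: the ends of a subdivided edge must differ in colour exactly if one of
  its two halves lies in \<open>M\<close> and the other does not. This prescribes a cut in
  \<open>G\<close>, and the colours of the new vertices follow.\<close>

lemma balanced_subdivide_edges:
  assumes G: "simple_graph G" "balanced G" and F: "F \<subseteq> edges G"
  shows "balanced (subdivide_edges G F)"
  unfolding balanced_def
proof
  fix M :: "('a + 'a set) set set"
  define odd where
    "odd e \<longleftrightarrow> (\<exists>u v. e = {u, v} \<and> {Inl u, Inr e} \<in> M \<and> {Inl v, Inr e} \<notin> M)" for e :: "'a set"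
  obtain f :: "'a \<Rightarrow> bool"
    where f: "\<And>x y. {x, y} \<in> edges G \<Longrightarrow>
      f x \<noteq> f y \<longleftrightarrow> {x, y} \<in> {e. if e \<in> F then odd e else Inl ` e \<in> M}"
    using balancedD[OF G(2), of "{e. if e \<in> F then odd e else Inl ` e \<in> M}"] by blast
  \<comment> \<open>Each end of \<open>e\<close> dictates a colour for \<open>Inr e\<close>; the
    choice of \<open>f\<close> makes the two demands agree, so the existential quantifier does not
    depend on the end.\<close>
  define h where "h = case_sum f (\<lambda>e. \<exists>u\<in>e. f u \<noteq> ({Inl u, Inr e} \<in> M))"
  have hF: "h (Inl u) \<noteq> h (Inr e) \<longleftrightarrow> {Inl u, Inr e} \<in> M" if ue: "e \<in> F" "u \<in> e" for u e
  proof -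
    obtain v where v: "e = {u, v}" "u \<noteq> v"
      using simple_graph_edge_atE[OF G(1) _ ue(2)] ue(1) F by (metis subsetD)
    have "odd e \<longleftrightarrow> ({Inl u, Inr e} \<in> M) \<noteq> ({Inl v, Inr e} \<in> M)"
      unfolding odd_def v(1) by (auto simp: doubleton_eq_iff insert_commute)
    moreover have "f u \<noteq> f v \<longleftrightarrow> odd e"
      using f[of u v] ue(1) F v(1) by auto
    ultimately have "f u \<noteq> ({Inl u, Inr e} \<in> M) \<longleftrightarrow> f v \<noteq> ({Inl v, Inr e} \<in> M)"
      by blast
    then have "h (Inr e) \<longleftrightarrow> f u \<noteq> ({Inl u, Inr e} \<in> M)"
      unfolding h_def using v(1) by auto
    then show ?thesis
      unfolding h_def by auto
  qed
  have "h x \<noteq> h y \<longleftrightarrow> {x, y} \<in> M" if xy: "{x, y} \<in> edges (subdivide_edges G F)" for x y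
  proof -
    consider e where "e \<in> edges G - F" "{x, y} = Inl ` e"
      | u e where "e \<in> F" "u \<in> e" "{x, y} = {Inl u, Inr e}"
      using xy by auto
    then show ?thesis
    proof cases
      case 1
      then obtain a b where "x = Inl a" "y = Inl b"
        by (metis imageE insertCI)
      moreover from this have "e = {a, b}"
        using 1(2) by (auto simp: inj_image_eq_iff[OF inj_Inl, of e "{a, b}", symmetric])
      ultimately show ?thesis
        using f[of a b] 1 unfolding h_def by auto
    next
      case 2
      then show ?thesis
        using hF[OF 2(1,2)] by (auto simp: doubleton_eq_iff insert_commute)
    qed
  qed
  then show "\<exists>h :: 'a + 'a set \<Rightarrow> bool. \<forall>x y. {x, y} \<in> edges (subdivide_edges G F) \<longrightarrow>
      (h x \<noteq> h y \<longleftrightarrow> {x, y} \<in> M)"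
    by blast
qed

section \<open>The effect of subdividing a single edge\<close>

lemma matching_lift:
  assumes "matching G M" "M \<inter> F = {}"
  shows "matching (subdivide_edges G F) ((`) Inl ` M)" "card ((`) Inl ` M) = card M"
proof -
  have "disjnt (Inl ` d) (Inl ` e)" if "d \<in> M" "e \<in> M" "d \<noteq> e" for d e
    using assms(1) pairwiseD[of disjnt M d e] that unfolding matching_def disjnt_def by auto
  then have "pairwise disjnt ((`) Inl ` M)"
    by (intro pairwise_imageI) blast
  then show "matching (subdivide_edges G F) ((`) Inl ` M)"
    using assms unfolding matching_def by auto
  show "card ((`) Inl ` M) = card M"
    by (intro card_image inj_onI) (simp add: inj_image_eq_iff)
qed

lemma matching_insert:
  assumes "matching G M" "e \<in> edges G" "e \<inter> \<Union>M = {}"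
  shows "matching G (insert e M)"
  using assms unfolding matching_def by (auto simp: pairwise_insert disjnt_def)

text \<open>A matching of the subdivided graph uses at most one half of \<open>e\<close>, as both
  contain \<open>Inr e\<close>. Gaining an edge therefore means using a half
  \<open>{Inl u, Inr e}\<close> next to a maximum matching of \<open>G\<close> that avoids
  \<open>u\<close>, and any such matching can be extended this way.\<close>

lemma matching_number_subdivide_edge:
  assumes G: "simple_graph G" and e: "e \<in> edges G"
  shows "matching_number G < matching_number (subdivide_edges G {e}) \<longleftrightarrow> (\<exists>u\<in>e. inessential G u)"
    (is "_ < matching_number ?H \<longleftrightarrow> _")
proof
  have H: "simple_graph ?H"
    using simple_graph_subdivide_edges[OF G] e by blast
  assume lt: "matching_number G < matching_number ?H"
  obtain M where M: "matching ?H M" "card M = matching_number ?H"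
    using maximum_matching_exists[OF H] unfolding maximum_matching_def by blast
  have fin: "finite M"
    using matching_finite[OF H M(1)] .
  \<comment> \<open>The part of \<open>M\<close> on unsubdivided edges, read back in
    \<open>G\<close>.\<close>
  define M0 where "M0 = {d \<in> edges G - {e}. Inl ` d \<in> M}"
  have M0: "matching G M0"
    unfolding matching_def
  proof
    show "M0 \<subseteq> edges G"
      unfolding M0_def by blast
    show "pairwise disjnt M0"
    proof (rule pairwiseI)
      fix d d'
      assume "d \<in> M0" "d' \<in> M0" "d \<noteq> d'"
      then have "Inl ` d \<in> M" "Inl ` d' \<in> M" "Inl ` d \<noteq> (Inl ` d' :: ('a + 'a set) set)"
        unfolding M0_def by (auto simp: inj_image_eq_iff)
      then have "disjnt (Inl ` d) (Inl ` d' :: ('a + 'a set) set)"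
        using M(1) unfolding matching_def by (metis pairwiseD)
      then show "disjnt d d'"
        unfolding disjnt_def by auto
    qed
  qed
  have card_M0: "card ((`) Inl ` M0) = card M0"
    by (intro card_image inj_onI) (simp add: inj_image_eq_iff)
  have le: "card M0 \<le> matching_number G"
    using matching_card_le[OF G M0] .
  have M_sub: "d \<in> (`) Inl ` M0 \<or> (\<exists>u\<in>e. d = {Inl u, Inr e})" if "d \<in> M" for d
  proof -
    have "d \<in> edges ?H"
      using M(1) that unfolding matching_def by blast
    then consider d' where "d' \<in> edges G - {e}" "d = Inl ` d'" | u where "u \<in> e" "d = {Inl u, Inr e}"
      by auto
    then show ?thesis
      using that unfolding M0_def by cases blast+
  qed
  have "\<exists>u\<in>e. {Inl u, Inr e} \<in> M"
  proof (rule ccontr)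
    assume "\<not> ?thesis"
    then have "M \<subseteq> (`) Inl ` M0"
      using M_sub by blast
    moreover have "(`) Inl ` M0 \<subseteq> M"
      unfolding M0_def by blast
    ultimately have "card M = card M0"
      using card_M0 by (metis subset_antisym)
    then show False
      using M(2) lt le by linarith
  qed
  then obtain u where u: "u \<in> e" "{Inl u, Inr e} \<in> M"
    by blast
  have "M \<subseteq> insert {Inl u, Inr e} ((`) Inl ` M0)"
  proof
    fix d
    assume d: "d \<in> M"
    show "d \<in> insert {Inl u, Inr e} ((`) Inl ` M0)"
    proof (cases "Inr e \<in> d")
      case True
      then have "d = {Inl u, Inr e}"
        using matching_eqI[OF M(1) d u(2)] by blast
      then show ?thesis
        by simp
    next
      case False
      then show ?thesis
        using M_sub[OF d] by blast
    qed
  qed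
  moreover have "finite ((`) (Inl :: 'a \<Rightarrow> 'a + 'a set) ` M0)"
    using matching_finite[OF G M0] by blast
  ultimately have "card M \<le> card (insert {Inl u, Inr e} ((`) Inl ` M0))"
    by (intro card_mono) auto
  also have "\<dots> \<le> Suc (card M0)"
    using card_M0 by (metis card_insert_le_m1 diff_Suc_1 le_refl zero_less_Suc)
  finally have "card M \<le> Suc (card M0)" .
  then have "maximum_matching G M0"
    using maximum_matchingI[OF G M0] lt M(2) by simp
  moreover have "u \<notin> \<Union>M0"
  proof
    assume "u \<in> \<Union>M0"
    then obtain d where "Inl ` d \<in> M" "u \<in> d"
      unfolding M0_def by blast
    then have "Inl ` d = {Inl u, Inr e}"
      using matching_eqI[OF M(1) _ u(2), of "Inl ` d" "Inl u"] by blast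
    then show False
      by auto
  qed
  ultimately show "\<exists>u\<in>e. inessential G u"
    using u(1) unfolding inessential_def by blast
next
  have H: "simple_graph ?H"
    using simple_graph_subdivide_edges[OF G] e by blast
  assume "\<exists>u\<in>e. inessential G u"
  then obtain u M where u: "u \<in> e" "u \<notin> \<Union>M" and M: "matching G M" "card M = matching_number G"
    unfolding inessential_def maximum_matching_def by blast
  define M' where "M' = (`) (Inl :: 'a \<Rightarrow> 'a + 'a set) ` M"
  \<comment> \<open>The lift applies because \<open>M\<close> misses \<open>u\<close> and so cannot
    contain \<open>e\<close>.\<close>
  have M': "matching ?H M'" "card M' = card M"
    using matching_lift[OF M(1), of "{e}"] u unfolding M'_def by auto
  have "{Inl u, Inr e} \<inter> \<Union>M' = {}"
    using u(2) unfolding M'_def by auto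
  then have "matching ?H (insert {Inl u, Inr e} M')" "{Inl u, Inr e} \<notin> M'"
    using matching_insert[OF M'(1)] u(1) by auto
  then have "Suc (card M) \<le> matching_number ?H"
    using matching_card_le[OF H] matching_finite[OF H M'(1)] M'(2) by fastforce
  then show "matching_number G < matching_number ?H"
    using M(2) by simp
qed

text \<open>The order grows by one, and the super domination number is the order minus the matching
  number; so it increases unless the matching number does.\<close>

lemma gamma_sp_subdivide_edge:
  assumes "simple_graph G" "balanced G" "e \<in> edges G"
  shows "gamma_sp G < gamma_sp (subdivide_edges G {e}) \<longleftrightarrow> (\<forall>u\<in>e. \<not> inessential G u)"
proof -
  have "finite (verts G)"
    using assms(1) unfolding simple_graph_def by blast
  then have "card (verts (subdivide_edges G {e})) = Suc (card (verts G))"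
    by (simp add: image_iff card_image)
  moreover have "simple_graph (subdivide_edges G {e})" "balanced (subdivide_edges G {e})"
    using assms simple_graph_subdivide_edges balanced_subdivide_edges by (metis empty_subsetI insert_subset)+
  ultimately have "gamma_sp G < gamma_sp (subdivide_edges G {e}) \<longleftrightarrow>
      \<not> matching_number G < matching_number (subdivide_edges G {e})"
    using gamma_sp_add_matching_number[of "subdivide_edges G {e}"]
      gamma_sp_add_matching_number[OF assms(1,2)] by auto
  then show ?thesis
    using matching_number_subdivide_edge[OF assms(1,3)] by blast
qed

text \<open>The empty subdivision only renames vertices. This inequality keeps 0 out of the set
  whose infimum defines \<open>sd_gamma_sp\<close>.\<close>

lemma gamma_sp_subdivide_none:
  assumes "simple_graph G" "balanced G"
  shows "gamma_sp (subdivide_edges G {}) \<le> gamma_sp G"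
proof -
  let ?H = "subdivide_edges G {}"
  have H: "simple_graph ?H" "balanced ?H"
    using assms simple_graph_subdivide_edges balanced_subdivide_edges by (metis empty_subsetI)+
  obtain M where M: "matching G M" "card M = matching_number G"
    using maximum_matching_exists[OF assms(1)] unfolding maximum_matching_def by blast
  have "matching_number G \<le> matching_number ?H"
    using matching_lift[OF M(1), of "{}"] M(2) matching_card_le[OF H(1)] by (metis Int_empty_right)
  moreover have "card (verts ?H) = card (verts G)"
    by (simp add: card_image)
  ultimately show ?thesis
    using gamma_sp_add_matching_number[OF H] gamma_sp_add_matching_number[OF assms] by simp
qed

lemma sd_gamma_sp_eq_1_iff:
  assumes "simple_graph G" "balanced G"
  shows "sd_gamma_sp G = 1 \<longleftrightarrow> (\<exists>e\<in>edges G. \<forall>u\<in>e. \<not> inessential G u)"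
proof -
  define A where
    "A = {enat (card F) |F. F \<subseteq> edges G \<and> gamma_sp G < gamma_sp (subdivide_edges G F)}"
  have sd: "sd_gamma_sp G = Inf A"
    unfolding sd_gamma_sp_def A_def ..
  have ge: "1 \<le> n" if n: "n \<in> A" for n
  proof -
    obtain F where F: "n = enat (card F)" "F \<subseteq> edges G"
      "gamma_sp G < gamma_sp (subdivide_edges G F)"
      using n unfolding A_def by blast
    then have "F \<noteq> {}"
      using gamma_sp_subdivide_none[OF assms] by auto
    moreover have "finite F"
      using F(2) simple_graph_finite_edges[OF assms(1)] finite_subset by blast
    ultimately show ?thesis
      using F(1) by (simp add: one_enat_def Suc_le_eq card_gt_0_iff)
  qed
  have "Inf A = 1 \<longleftrightarrow> 1 \<in> A"
  proof
    assume "Inf A = 1"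
    \<comment> \<open>The infimum of the empty set is infinite; over a nonempty set of extended
      naturals the infimum is attained.\<close>
    then have "A \<noteq> {}"
      by (metis Inf_empty infinity_ne_i1 top_enat_def)
    then have "Inf A \<in> A"
      unfolding Inf_enat_def using LeastI[of "\<lambda>x. x \<in> A"] by auto
    then show "1 \<in> A"
      using \<open>Inf A = 1\<close> by simp
  next
    assume "1 \<in> A"
    then show "Inf A = 1"
      using ge Inf_lower[of 1 A] Inf_greatest[of A 1] by (metis antisym)
  qed
  also have "1 \<in> A \<longleftrightarrow> (\<exists>e\<in>edges G. gamma_sp G < gamma_sp (subdivide_edges G {e}))"
  proof
    assume "1 \<in> A"
    then obtain F where "card F = 1" "F \<subseteq> edges G" "gamma_sp G < gamma_sp (subdivide_edges G F)"
      unfolding A_def one_enat_def by auto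
    then show "\<exists>e\<in>edges G. gamma_sp G < gamma_sp (subdivide_edges G {e})"
      by (metis card_1_singletonE insert_subset)
  next
    assume "\<exists>e\<in>edges G. gamma_sp G < gamma_sp (subdivide_edges G {e})"
    then obtain e where "e \<in> edges G" "gamma_sp G < gamma_sp (subdivide_edges G {e})"
      by blast
    then show "1 \<in> A"
      unfolding A_def one_enat_def by (intro CollectI exI[of _ "{e}"]) simp
  qed
  finally show ?thesis
    using gamma_sp_subdivide_edge[OF assms] sd by auto
qed

section \<open>Joining a star\<close>

lemma verts_star [simp]: "verts (star c L) = insert c L"
  unfolding star_def by simp

lemma edges_star [simp]: "edges (star c L) = (\<lambda>x. {c, x}) ` L"
  unfolding star_def by auto

lemma verts_join_star [simp]: "verts (join_star G v c L) = verts G \<union> insert c L"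
  unfolding join_star_def by simp

lemma edges_join_star [simp]:
  "edges (join_star G v c L) = edges G \<union> (\<lambda>x. {c, x}) ` insert v L"
  unfolding join_star_def by (auto simp: insert_commute)

abbreviation single_vertex :: "'a \<Rightarrow> 'a ugraph" where
  "single_vertex v \<equiv> \<lparr>verts = {v}, edges = {}\<rparr>"

text \<open>Treating one leaf as the old graph reduces the base case of \<open>family_U\<close> to
  the joining step.\<close>

lemma star_eq_join_star: "star c (insert v L) = join_star (single_vertex v) v c L"
  by (auto intro!: ugraph.equality simp: insert_commute)

lemma simple_graph_single_vertex: "simple_graph (single_vertex v)"
  unfolding simple_graph_def by simp

lemma balanced_single_vertex: "balanced (single_vertex v)"
  unfolding balanced_def by simp

lemma inessential_single_vertex: "inessential (single_vertex v) v"
proof -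
  obtain M where "maximum_matching (single_vertex v) M"
    using maximum_matching_exists[OF simple_graph_single_vertex] .
  then show ?thesis
    unfolding inessential_def maximum_matching_def matching_def by auto
qed

text \<open>The set \<open>L\<close> may be empty here, so that the tree with a single edge also
  arises as a join.\<close>

locale star_join =
  fixes G :: "'a ugraph" and v c :: 'a and L :: "'a set"
  assumes simple: "simple_graph G"
    and v: "v \<in> verts G"
    and finite_L: "finite L"
    and c: "c \<notin> L"
    and fresh: "verts (star c L) \<inter> verts G = {}"
begin

abbreviation H :: "'a ugraph" where
  "H \<equiv> join_star G v c L"

lemma edge_G_disjoint:
  assumes "e \<in> edges G"
  shows "e \<inter> insert c L = {}"
  using simple_graph_edgeE[OF simple assms] fresh by auto

lemma simple_graph_H: "simple_graph H"
  unfolding simple_graph_def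
proof (intro conjI ballI)
  show "finite (verts H)"
    using simple finite_L unfolding simple_graph_def by simp
  fix e
  assume "e \<in> edges H"
  then consider "e \<in> edges G" | x where "x \<in> insert v L" "e = {c, x}"
    by auto
  then show "\<exists>u\<in>verts H. \<exists>w\<in>verts H. u \<noteq> w \<and> e = {u, w}"
  proof cases
    case 1
    then show ?thesis
      using simple_graph_edgeE[OF simple] by (metis UnCI verts_join_star)
  next
    case 2
    then show ?thesis
      using v c fresh by - (rule bexI[of _ c], rule bexI[of _ x], auto)
  qed
qed

text \<open>The added edges form a star around \<open>c\<close> meeting \<open>G\<close> only in
  \<open>v\<close>: the colour of \<open>v\<close> determines that of \<open>c\<close>, which
  determines those of the leaves.\<close>

lemma balanced_H:
  assumes "balanced G"
  shows "balanced H"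
  unfolding balanced_def
proof
  fix M
  obtain f :: "'a \<Rightarrow> bool" where f: "\<And>x y. {x, y} \<in> edges G \<Longrightarrow> f x \<noteq> f y \<longleftrightarrow> {x, y} \<in> M"
    using balancedD[OF assms, of M] by blast
  define fc where "fc \<longleftrightarrow> f v \<noteq> ({c, v} \<in> M)"
  define h where
    "h x \<longleftrightarrow> (if x = c then fc else if x \<in> L then fc \<noteq> ({c, x} \<in> M) else f x)" for x
  have v': "v \<noteq> c" "v \<notin> L"
    using v fresh by auto
  have hc: "h c \<noteq> h x \<longleftrightarrow> {c, x} \<in> M" if "x \<in> insert v L" for x
    using that v' c unfolding h_def fc_def by auto
  have "h x \<noteq> h y \<longleftrightarrow> {x, y} \<in> M" if xy: "{x, y} \<in> edges H" for x y
  proof (cases "{x, y} \<in> edges G")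
    case True
    then show ?thesis
      using f[OF True] edge_G_disjoint[OF True] unfolding h_def by auto
  next
    case False
    then obtain z where "z \<in> insert v L" "{x, y} = {c, z}"
      using xy by auto
    then show ?thesis
      using hc[of z] by (auto simp: doubleton_eq_iff insert_commute)
  qed
  then show "\<exists>h :: 'a \<Rightarrow> bool. \<forall>x y. {x, y} \<in> edges H \<longrightarrow> (h x \<noteq> h y \<longleftrightarrow> {x, y} \<in> M)"
    by blast
qed

lemma matching_extend:
  assumes M: "matching G M" and x: "x \<in> insert v L" "x = v \<Longrightarrow> v \<notin> \<Union>M"
  shows "matching H (insert {c, x} M)" "card (insert {c, x} M) = Suc (card M)"
proof -
  have "e \<inter> insert c L = {}" if "e \<in> M" for e
    using that M edge_G_disjoint unfolding matching_def by blast
  then have disj: "{c, x} \<inter> \<Union>M = {}"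
    using x by auto
  have "matching H M"
    using M unfolding matching_def by auto
  then show "matching H (insert {c, x} M)"
    using disj x(1) by (intro matching_insert) auto
  show "card (insert {c, x} M) = Suc (card M)"
    using matching_finite[OF simple M] disj by (intro card_insert_disjoint) auto
qed

text \<open>All added edges contain \<open>c\<close>, so a matching uses at most one of
  them.\<close>

lemma matching_restrict:
  assumes M: "matching H M"
  shows "matching G (M \<inter> edges G)" "card M \<le> Suc (card (M \<inter> edges G))"
proof -
  show "matching G (M \<inter> edges G)"
    using M unfolding matching_def pairwise_def by blast
  have fin: "finite M"
    using matching_finite[OF simple_graph_H M] .
  have c_in: "c \<in> e" if "e \<in> M - edges G" for e
    using that M unfolding matching_def by auto
  have "card (M - edges G) \<le> Suc 0"
    using matching_eqI[OF M _ _ c_in c_in] fin by (subst card_le_Suc0_iff_eq) auto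
  then show "card M \<le> Suc (card (M \<inter> edges G))"
    using card_Int_Diff[OF fin, of "edges G"] by simp
qed

lemma matching_number_H:
  assumes "L \<noteq> {}"
  shows "matching_number H = Suc (matching_number G)"
proof (rule antisym)
  obtain M where "matching H M" "card M = matching_number H"
    using maximum_matching_exists[OF simple_graph_H] unfolding maximum_matching_def by blast
  then show "matching_number H \<le> Suc (matching_number G)"
    using matching_restrict[of M] matching_card_le[OF simple, of "M \<inter> edges G"] by simp
next
  obtain M where M: "matching G M" "card M = matching_number G"
    using maximum_matching_exists[OF simple] unfolding maximum_matching_def by blast
  obtain l where "l \<in> L"
    using assms by blast
  moreover from this have "l \<noteq> v"
    using v fresh by auto
  ultimately show "Suc (matching_number G) \<le> matching_number H"
    using matching_extend[OF M(1), of l] M(2) matching_card_le[OF simple_graph_H] by force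
qed

text \<open>Maximum matchings pass between the graphs by dropping the edge at \<open>c\<close> or
  adding an edge from \<open>c\<close> to a leaf; neither covers a further vertex of
  \<open>G\<close>.\<close>

lemma inessential_H_iff:
  assumes L: "L \<noteq> {}" and x: "x \<in> verts G"
  shows "inessential H x \<longleftrightarrow> inessential G x"
proof
  assume "inessential H x"
  then obtain M where M: "matching H M" "card M = matching_number H" "x \<notin> \<Union>M"
    unfolding inessential_def maximum_matching_def by blast
  have "maximum_matching G (M \<inter> edges G)"
    using matching_restrict[OF M(1)] M(2) matching_number_H[OF L] maximum_matchingI[OF simple]
    by simp
  then show "inessential G x"
    using M(3) unfolding inessential_def by blast
next
  assume "inessential G x"
  then obtain M where M: "matching G M" "card M = matching_number G" "x \<notin> \<Union>M"
    unfolding inessential_def maximum_matching_def by blast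
  obtain l where l: "l \<in> L"
    using L by blast
  then have "l \<noteq> v" "x \<notin> {c, l}"
    using v x fresh by auto
  then have "maximum_matching H (insert {c, l} M)" "x \<notin> \<Union>(insert {c, l} M)"
    using matching_extend[OF M(1), of l] l M matching_number_H[OF L]
    unfolding maximum_matching_def by auto
  then show "inessential H x"
    unfolding inessential_def by blast
qed

text \<open>When a maximum matching misses \<open>v\<close>, the center can be matched to
  \<open>v\<close>, which leaves all of \<open>L\<close> uncovered.\<close>

lemma inessential_leaf:
  assumes "inessential G v" "l \<in> L"
  shows "inessential H l"
proof -
  obtain M where M: "matching G M" "card M = matching_number G" "v \<notin> \<Union>M"
    using assms(1) unfolding inessential_def maximum_matching_def by blast
  have L: "L \<noteq> {}"
    using assms(2) by blast
  have "l \<notin> \<Union>M"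
    using M(1) edge_G_disjoint assms(2) unfolding matching_def by blast
  then have "l \<notin> \<Union>(insert {c, v} M)"
    using assms(2) v c fresh by auto
  moreover have "maximum_matching H (insert {c, v} M)"
    using matching_extend[OF M(1), of v] M matching_number_H[OF L]
    unfolding maximum_matching_def by auto
  ultimately show ?thesis
    unfolding inessential_def by blast
qed

text \<open>A matching avoiding \<open>c\<close> lives in \<open>G\<close> and is one edge short, so
  \<open>c\<close> is essential and the edge from \<open>c\<close> to \<open>v\<close> forces
  \<open>v\<close> to be inessential.\<close>

lemma inessential_join_leafD:
  assumes L: "L \<noteq> {}" and edges_H: "\<forall>e\<in>edges H. \<exists>u\<in>e. inessential H u"
  shows "inessential G v" "\<forall>e\<in>edges G. \<exists>u\<in>e. inessential G u"
proof -
  have "\<not> inessential H c"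
  proof
    assume "inessential H c"
    then obtain M where M: "matching H M" "card M = matching_number H" "c \<notin> \<Union>M"
      unfolding inessential_def maximum_matching_def by blast
    then have "M \<subseteq> edges G"
      unfolding matching_def by auto
    then have "matching G M"
      using M(1) unfolding matching_def by blast
    then show False
      using M(2) matching_card_le[OF simple] matching_number_H[OF L] by fastforce
  qed
  then have "inessential H v"
    using edges_H by auto
  then show "inessential G v"
    using inessential_H_iff[OF L v] by blast
  show "\<forall>e\<in>edges G. \<exists>u\<in>e. inessential G u"
  proof
    fix e
    assume e: "e \<in> edges G"
    then obtain u where "u \<in> e" "inessential H u"
      using edges_H by auto
    moreover from e this have "u \<in> verts G"
      using simple_graph_edgeE[OF simple] by blast
    ultimately show "\<exists>u\<in>e. inessential G u"
      using inessential_H_iff[OF L] by blast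
  qed
qed

lemma inessential_cover_H:
  assumes "L \<noteq> {}" "inessential G v" "\<forall>e\<in>edges G. \<exists>u\<in>e. inessential G u"
  shows "\<forall>e\<in>edges H. \<exists>u\<in>e. inessential H u"
proof
  fix e
  assume "e \<in> edges H"
  then consider "e \<in> edges G" | "e = {c, v}" | l where "l \<in> L" "e = {c, l}"
    by auto
  then show "\<exists>u\<in>e. inessential H u"
  proof cases
    case 1
    then obtain u where "u \<in> e" "inessential G u"
      using assms(3) by blast
    moreover from 1 this have "u \<in> verts G"
      using simple_graph_edgeE[OF simple] by blast
    ultimately show ?thesis
      using inessential_H_iff[OF assms(1)] by blast
  next
    case 2
    then show ?thesis
      using inessential_H_iff[OF assms(1) v] assms(2) by blast
  next
    case 3
    then show ?thesis
      using inessential_leaf[OF assms(2)] by blast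
  qed
qed

end

lemma family_U_properties:
  assumes "T \<in> family_U"
  shows "simple_graph T \<and> balanced T \<and> (\<forall>e\<in>edges T. \<exists>u\<in>e. inessential T u)"
  using assms
proof induction
  case (base L c)
  then obtain v where v: "v \<in> L"
    by fastforce
  define L' where "L' = L - {v}"
  have L: "L = insert v L'"
    using v unfolding L'_def by blast
  have "L' \<noteq> {}"
    using base(3) unfolding L by auto
  interpret star_join "single_vertex v" v c L'
    using base v unfolding L'_def by unfold_locales (auto intro: simple_graph_single_vertex)
  show ?case
    unfolding L star_eq_join_star
    using simple_graph_H balanced_H[OF balanced_single_vertex]
      inessential_cover_H[OF \<open>L' \<noteq> {}\<close> inessential_single_vertex] by simp
next
  case (op_U1 T' v L c)
  have v: "v \<in> verts T'"
    using op_U1 unfolding U1_vertex_def by blast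
  interpret star_join T' v c L
    using op_U1 v by unfold_locales auto
  have "L \<noteq> {}"
    using op_U1 by auto
  moreover have "inessential T' v"
    using op_U1.hyps(2) op_U1.IH U1_vertex_iff_inessential[OF _ _ v] by blast
  ultimately show ?case
    using op_U1 simple_graph_H balanced_H inessential_cover_H by blast
qed

section \<open>Trees\<close>

definition graph_path :: "'a ugraph \<Rightarrow> 'a list \<Rightarrow> bool" where
  "graph_path G p \<longleftrightarrow> set p \<subseteq> verts G \<and> distinct p \<and> successively (\<lambda>x y. {x, y} \<in> edges G) p"

lemma graph_path_Cons2:
  "graph_path G (x # y # r) \<longleftrightarrow>
     x \<in> verts G \<and> {x, y} \<in> edges G \<and> x \<notin> set (y # r) \<and> graph_path G (y # r)"
  unfolding graph_path_def by auto

text \<open>A second neighbor of \<open>x\<close> would either prolong the path or lie on it and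
  close a cycle.\<close>

lemma longest_path_end_leaf:
  assumes T: "is_tree T" and p: "graph_path T (x # y # r)"
    and longest: "\<And>q. graph_path T q \<Longrightarrow> length q \<le> length (x # y # r)"
  shows "neighborhood T x = {y}"
proof -
  have simple: "simple_graph T"
    using T unfolding is_tree_def by blast
  have "w = y" if w: "{x, w} \<in> edges T" for w
  proof (rule ccontr)
    assume "w \<noteq> y"
    have wx: "w \<in> verts T" "w \<noteq> x" "{w, x} \<in> edges T"
      using simple_graph_edgeD[OF simple w] w by (auto simp: insert_commute)
    show False
    proof (cases "w \<in> set r")
      case False
      then have "graph_path T (w # x # y # r)"
        using p wx \<open>w \<noteq> y\<close> unfolding graph_path_Cons2[of T w] by simp
      then show False
        using longest by fastforce
    next
      case True
      then obtain r1 r2 where "r = r1 @ w # r2"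
        by (meson split_list)
      then have "graph_cycle T (x # y # r1 @ [w])"
        using p wx unfolding graph_cycle_def graph_path_def
        by (auto simp: successively_append_iff successively_Cons hd_append split: if_splits)
      then show False
        using T unfolding is_tree_def by blast
    qed
  qed
  moreover have "{x, y} \<in> edges T"
    using p unfolding graph_path_Cons2 by blast
  ultimately show ?thesis
    unfolding neighborhood_def by blast
qed

text \<open>Take \<open>c\<close> as the second vertex of a longest path and \<open>v\<close> as the
  third. Any other neighbor of \<open>c\<close> can replace the first vertex, so it too ends a
  longest path. The last conclusion controls the case where \<open>v\<close> is the only neighbor of
  \<open>c\<close>.\<close>

lemma pendant_star:
  assumes T: "is_tree T" and "edges T \<noteq> {}"
  obtains c v where "{c, v} \<in> edges T"
    "\<forall>w. {c, w} \<in> edges T \<longrightarrow> w \<noteq> v \<longrightarrow> neighborhood T w = {c}"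
    "(\<exists>w. {c, w} \<in> edges T \<and> w \<noteq> v) \<or> neighborhood T v = {c}"
proof -
  have simple: "simple_graph T"
    using T unfolding is_tree_def by blast
  obtain a b where ab: "{a, b} \<in> edges T"
    using assms(2) simple_graph_edgeE[OF simple] by (metis all_not_in_conv)
  have ab_path: "graph_path T [a, b]"
    using ab simple_graph_edgeD[OF simple ab] unfolding graph_path_def by auto
  have "length q \<le> card (verts T)" if "graph_path T q" for q
    using that simple unfolding graph_path_def simple_graph_def
    by (metis card_mono distinct_card)
  then obtain p where p: "graph_path T p" and longest: "\<And>q. graph_path T q \<Longrightarrow> length q \<le> length p"
    using ex_has_greatest_nat[of "graph_path T" "[a, b]" length "Suc (card (verts T))"] ab_path
    by (metis less_Suc_eq_le)
  \<comment> \<open>The path along one edge already has two vertices, which rules out shorter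
    lists.\<close>
  obtain l c r where lcr: "p = l # c # r"
    using longest[OF ab_path] by (cases p rule: remdups_adj.cases) auto
  have leaf: "neighborhood T w = {c}" if "{c, w} \<in> edges T" "w \<notin> set r" for w
  proof (rule longest_path_end_leaf[OF T])
    show "graph_path T (w # c # r)"
      using p that simple_graph_edgeD[OF simple that(1)]
      unfolding lcr graph_path_Cons2 by (auto simp: insert_commute)
    show "length q \<le> length (w # c # r)" if "graph_path T q" for q
      using longest[OF that] lcr by simp
  qed
  have cl: "{c, l} \<in> edges T" "l \<notin> set r"
    using p unfolding lcr graph_path_Cons2 by (auto simp: insert_commute)
  show thesis
  proof (cases r)
    case Nil
    \<comment> \<open>There is no third vertex, so the leaf \<open>l\<close> itself takes the place
      of \<open>v\<close>, with the second disjunct.\<close>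
    then show ?thesis
      using that[of c l] cl leaf by simp
  next
    case (Cons v r')
    have cv: "{c, v} \<in> edges T"
      using p unfolding lcr Cons graph_path_Cons2 by blast
    have "w \<notin> set r'" if w: "{c, w} \<in> edges T" for w
    proof
      assume "w \<in> set r'"
      then obtain r1 r2 where "r' = r1 @ w # r2"
        by (meson split_list)
      then have "graph_cycle T (c # v # r1 @ [w])"
        using p w unfolding lcr Cons graph_cycle_def graph_path_def
        by (auto simp: successively_append_iff successively_Cons insert_commute hd_append split: if_splits)
      then show False
        using T unfolding is_tree_def by blast
    qed
    then have "neighborhood T w = {c}" if "{c, w} \<in> edges T" "w \<noteq> v" for w
      using leaf that Cons by simp
    moreover have "l \<noteq> v"
      using cl(2) Cons by auto
    ultimately show ?thesis
      using that[of c v] cv cl(1) by blast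
  qed
qed

section \<open>Splitting a pendant star off a tree\<close>

lemma rtrancl_edges_map:
  assumes "(a, b) \<in> {(x, y). {x, y} \<in> E}\<^sup>*"
    and "\<And>x y. {x, y} \<in> E \<Longrightarrow> f x = f y \<or> {f x, f y} \<in> E'"
  shows "(f a, f b) \<in> {(x, y). {x, y} \<in> E'}\<^sup>*"
  using assms(1)
proof induction
  case (step y z)
  then show ?case
    using assms(2)[of y z] by (auto intro: rtrancl_into_rtrancl)
qed simp

lemma tree_join_star_cases:
  assumes T: "is_tree T"
  obtains (single) v where "T = single_vertex v"
  | (join) T' v c L where "T = join_star T' v c L" "is_tree T'" "star_join T' v c L"
      "L \<noteq> {} \<or> T' = single_vertex v"
proof (cases "edges T = {}")
  case True
  obtain v where v: "v \<in> verts T"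
    using T unfolding is_tree_def connected_graph_def by blast
  have "w = v" if "w \<in> verts T" for w
    using T v that True unfolding is_tree_def connected_graph_def by auto
  then have "verts T = {v}"
    using v by blast
  then have "T = single_vertex v"
    using True by (intro ugraph.equality) auto
  then show thesis
    using single by blast
next
  case False
  have simple: "simple_graph T"
    and conn: "\<And>u w. u \<in> verts T \<Longrightarrow> w \<in> verts T \<Longrightarrow> (u, w) \<in> {(x, y). {x, y} \<in> edges T}\<^sup>*"
    using T unfolding is_tree_def connected_graph_def by auto
  obtain c v where cv: "{c, v} \<in> edges T"
    and leaf: "\<forall>w. {c, w} \<in> edges T \<longrightarrow> w \<noteq> v \<longrightarrow> neighborhood T w = {c}"
    and v_leaf: "(\<exists>w. {c, w} \<in> edges T \<and> w \<noteq> v) \<or> neighborhood T v = {c}"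
    using pendant_star[OF T False] .
  note cv' = simple_graph_edgeD[OF simple cv]
  define L where "L = neighborhood T c - {v}"
  have L: "w \<in> L \<longleftrightarrow> {c, w} \<in> edges T \<and> w \<noteq> v" for w
    unfolding L_def neighborhood_def by blast
  have L_verts: "L \<subseteq> verts T"
    using simple_graph_edgeD[OF simple] L by blast
  have c_L: "c \<notin> L"
    using simple_graph_edgeD[OF simple] L by blast
  have L_edge: "{w, z} \<in> edges T \<longleftrightarrow> z = c" if "w \<in> L" for w z
    using leaf that L unfolding neighborhood_def by blast
  define T' where "T' = \<lparr>verts = verts T - insert c L, edges = {e \<in> edges T. e \<inter> insert c L = {}}\<rparr>"
  have v_T': "v \<in> verts T'"
    using cv' L unfolding T'_def by simp
  have edge_cases: "{x, y} \<in> edges T' \<or> x = c \<and> y \<in> insert v L \<or> y = c \<and> x \<in> insert v L"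
    if xy: "{x, y} \<in> edges T" for x y
  proof (cases "x = c \<or> y = c")
    case True
    moreover have "w \<in> insert v L" if "{c, w} \<in> edges T" for w
      using that L by blast
    ultimately show ?thesis
      using xy by (metis insert_commute)
  next
    case False
    then have "x \<notin> L" "y \<notin> L"
      using xy L_edge[of x y] L_edge[of y x] by (auto simp: insert_commute)
    then show ?thesis
      using xy False unfolding T'_def by auto
  qed
  have eq: "T = join_star T' v c L"
  proof (rule ugraph.equality)
    show "verts T = verts (join_star T' v c L)"
      using L_verts cv' unfolding T'_def by auto
    show "edges T = edges (join_star T' v c L)"
    proof (intro equalityI subsetI)
      fix e
      assume e: "e \<in> edges T"
      with simple_graph_edgeE[OF simple] obtain x y where xy: "e = {x, y}"
        by metis
      then show "e \<in> edges (join_star T' v c L)"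
        using edge_cases[of x y] e by (auto simp: insert_commute)
    next
      fix e
      assume "e \<in> edges (join_star T' v c L)"
      then show "e \<in> edges T"
        using cv L unfolding T'_def by auto
    qed
  qed simp
  have simple': "simple_graph T'"
    unfolding simple_graph_def
  proof (intro conjI ballI)
    show "finite (verts T')"
      using simple unfolding T'_def simple_graph_def by simp
    fix e
    assume "e \<in> edges T'"
    then show "\<exists>u\<in>verts T'. \<exists>w\<in>verts T'. u \<noteq> w \<and> e = {u, w}"
      using simple unfolding T'_def simple_graph_def by fastforce
  qed
  have "connected_graph T'"
    unfolding connected_graph_def
  proof (intro conjI ballI)
    show "verts T' \<noteq> {}"
      using v_T' by blast
    fix a b
    assume ab: "a \<in> verts T'" "b \<in> verts T'"
    \<comment> \<open>Contracting the removed star to \<open>v\<close> turns walks of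
      \<open>T\<close> into walks of \<open>T'\<close>, which gives connectedness.\<close>
    define f where "f x = (if x \<in> insert c L then v else x)" for x
    have "(f a, f b) \<in> {(x, y). {x, y} \<in> edges T'}\<^sup>*"
    proof (rule rtrancl_edges_map[where f = f and a = a and b = b])
      show "(a, b) \<in> {(x, y). {x, y} \<in> edges T}\<^sup>*"
        using ab conn unfolding T'_def by simp
      show "f x = f y \<or> {f x, f y} \<in> edges T'" if "{x, y} \<in> edges T" for x y
        using edge_cases[OF that] unfolding f_def T'_def by auto
    qed
    then show "(a, b) \<in> {(x, y). {x, y} \<in> edges T'}\<^sup>*"
      using ab unfolding f_def T'_def by simp
  qed
  moreover have "\<nexists>p. graph_cycle T' p"
  proof
    assume "\<exists>p. graph_cycle T' p"
    then obtain p where "graph_cycle T' p" ..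
    then have "graph_cycle T p"
      unfolding graph_cycle_def T'_def by (auto elim: successively_mono)
    then show False
      using T unfolding is_tree_def by blast
  qed
  ultimately have tree': "is_tree T'"
    using simple' unfolding is_tree_def by blast
  have "finite L"
    using L_verts simple finite_subset unfolding simple_graph_def by blast
  then have join': "star_join T' v c L"
    using simple' v_T' c_L by unfold_locales (auto simp: T'_def)
  \<comment> \<open>With no leaves in \<open>L\<close>, the vertex \<open>v\<close> is adjacent to
    \<open>c\<close> only, hence isolated in the connected graph \<open>T'\<close>.\<close>
  have "T' = single_vertex v" if "L = {}"
  proof -
    have nbr: "neighborhood T v = {c}"
      using v_leaf L that by blast
    then have no_edge: "{v, w} \<notin> edges T'" for w
      unfolding neighborhood_def T'_def by auto
    have "w = v" if "w \<in> verts T'" for w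
    proof -
      have "(v, w) \<in> {(x, y). {x, y} \<in> edges T'}\<^sup>*"
        using tree' v_T' that unfolding is_tree_def connected_graph_def by blast
      then show ?thesis
        using no_edge by (auto elim: converse_rtranclE)
    qed
    then have verts': "verts T' = {v}"
      using v_T' by blast
    then have "edges T' = {}"
      using simple_graph_edgeE[OF simple'] by (metis all_not_in_conv singletonD)
    then show ?thesis
      using verts' by (intro ugraph.equality) auto
  qed
  then show thesis
    using join[OF eq tree' join'] by blast
qed

lemma tree_induct [consumes 1, case_names single join]:
  assumes "is_tree T"
    and single: "\<And>v. P (single_vertex v)"
    and join: "\<And>T' v c L. is_tree T' \<Longrightarrow> P T' \<Longrightarrow> star_join T' v c L \<Longrightarrow>
      L \<noteq> {} \<or> T' = single_vertex v \<Longrightarrow> P (join_star T' v c L)"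
  shows "P T"
  using assms(1)
proof (induction "card (verts T)" arbitrary: T rule: less_induct)
  case less
  from less.prems show ?case
  proof (cases rule: tree_join_star_cases)
    case (single v)
    then show ?thesis
      using assms(2) by simp
  next
    case (join T' v c L)
    interpret star_join T' v c L
      by (rule join)
    have "card (verts T') < card (verts T)"
      using simple_graph_H fresh unfolding join(1) simple_graph_def
      by (intro psubset_card_mono) auto
    then show ?thesis
      using less.hyps assms(3) join by metis
  qed
qed

lemma balanced_tree:
  assumes "is_tree T"
  shows "balanced T"
  using assms
proof (induction rule: tree_induct)
  case (single v)
  show ?case
    by (rule balanced_single_vertex)
next
  case (join T' v c L)
  then show ?case
    by (metis star_join.balanced_H)
qed

text \<open>Splitting off a pendant star leaves a smaller tree that inherits the hypothesis on
  edges, and makes \<open>v\<close> inessential, which is the condition for undoing the split by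
  operation \<open>U1\<close>. If only \<open>v\<close> remains, the tree is a star.\<close>

lemma tree_in_family_U:
  assumes "is_tree T" "card (verts T) \<ge> 2" "\<forall>e\<in>edges T. \<exists>u\<in>e. inessential T u"
  shows "T \<in> family_U"
  using assms
proof (induction rule: tree_induct)
  case (single v)
  then show ?case
    by simp
next
  case (join T' v c L)
  interpret star_join T' v c L
    by (rule join)
  show ?case
  proof (cases "T' = single_vertex v")
    case True
    have star: "H = star c (insert v L)"
      unfolding True star_eq_join_star ..
    \<comment> \<open>Otherwise the tree is a single edge, whose unique maximum matching covers both
      ends; this is why the base stars have order at least three.\<close>
    have "L \<noteq> {}"
    proof
      assume "L = {}"
      then have edges: "edges H = {{c, v}}"
        unfolding True by simp
      then have "\<exists>u\<in>{c, v}. inessential H u"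
        using join.prems(2) by simp
      then obtain u M where u: "u \<in> {c, v}" "u \<notin> \<Union>M" and M: "maximum_matching H M"
        unfolding inessential_def by blast
      then have "M \<subseteq> {{c, v}}"
        using edges unfolding maximum_matching_def matching_def by metis
      then have "M = {}"
        using u by blast
      moreover have "matching H {{c, v}}"
        unfolding matching_def edges by simp
      ultimately show False
        using M matching_card_le[OF simple_graph_H] unfolding maximum_matching_def by fastforce
    qed
    moreover have "v \<notin> L"
      using v fresh by auto
    ultimately have "card (insert v L) \<ge> 2"
      using finite_L by (simp add: numeral_2_eq_2 Suc_le_eq card_gt_0_iff)
    then show ?thesis
      unfolding star using finite_L v c fresh by (intro family_U.base) auto
  next
    case False
    then have L: "L \<noteq> {}"
      using join.hyps by blast
    have "card (verts T') \<ge> 2"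
    proof (rule ccontr)
      assume "\<not> ?thesis"
      then have "card (verts T') \<le> Suc 0"
        by simp
      then have verts': "verts T' = {v}"
        using v simple card_le_Suc0_iff_eq unfolding simple_graph_def by blast
      then have "edges T' = {}"
        using simple_graph_edgeE[OF simple] by (metis all_not_in_conv singletonD)
      then show False
        using False verts' by (auto intro: ugraph.equality)
    qed
    then have "T' \<in> family_U"
      using join.IH inessential_join_leafD[OF L join.prems(2)] by blast
    moreover have "U1_vertex T' v"
      using U1_vertex_iff_inessential[OF simple _ v] balanced_tree join.hyps
        inessential_join_leafD[OF L join.prems(2)] by blast
    moreover have "card L + 1 \<ge> 2"
      using L finite_L by (simp add: Suc_le_eq card_gt_0_iff)
    ultimately show ?thesis
      using finite_L c fresh by (intro family_U.op_U1)
  qed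
qed

theorem theorem3p5:
  fixes T :: "'a ugraph"
  assumes "is_tree T"
  shows "sd_gamma_sp T = 1 \<longleftrightarrow> T \<in> family_P"
proof -
  have simple: "simple_graph T"
    using assms unfolding is_tree_def by blast
  have sd: "sd_gamma_sp T = 1 \<longleftrightarrow> (\<exists>e\<in>edges T. \<forall>u\<in>e. \<not> inessential T u)"
    using sd_gamma_sp_eq_1_iff[OF simple balanced_tree[OF assms]] .
  \<comment> \<open>An edge with two essential ends makes the tree nontrivial, as membership in
    \<open>family_P\<close> demands.\<close>
  have "card (verts T) \<ge> 2" if e: "e \<in> edges T" for e
  proof -
    from simple_graph_edgeE[OF simple e] obtain u v
      where "u \<in> verts T" "v \<in> verts T" "u \<noteq> v" by metis
    then have "\<not> card (verts T) \<le> Suc 0"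
      using simple card_le_Suc0_iff_eq unfolding simple_graph_def by blast
    then show ?thesis
      by simp
  qed
  then show ?thesis
    using sd assms family_U_properties[of T] tree_in_family_U[OF assms]
    unfolding family_P_def by blast
qed

end
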